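(* Let $G$ be an abelian group (written additively), let $\alpha\in\mathrm{Aut}(G)$ satisfy $\alpha^2=1$, and let $G_\alpha=(G,\cdot)$ be the set $G$ with the operation $x\cdot y:=\alpha(x)+y$. Then $G_\alpha$ is a group if and only if $\alpha=1$ (the identity automorphism). *)

theory Defs
  imports "HOL-Algebra.Bij"
begin

text \<open>
  A set with a binary operation and no designated identity element. The identity is quantified
  existentially, because the record type underlying the locale \<^locale>\<open>group\<close> carries it as data.
\<close>

definition group_under :: "'a set \<Rightarrow> ('a \<Rightarrow> 'a \<Rightarrow> 'a) \<Rightarrow> bool"
  where "group_under A f \<longleftrightarrow> (\<exists>e. group \<lparr>carrier = A, mult = f, one = e\<rparr>)"

text \<open>
  The abelian group is a \<^locale>\<open>comm_group\<close>, so the sum \<open>\<alpha>(x) + y\<close> is written with \<open>\<otimes>\<close>.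
\<close>

definition twisted_op :: "('a, 'b) monoid_scheme \<Rightarrow> ('a \<Rightarrow> 'a) \<Rightarrow> 'a \<Rightarrow> 'a \<Rightarrow> 'a"
  where "twisted_op G \<alpha> x y = \<alpha> x \<otimes>\<^bsub>G\<^esub> y"

end

theory Submission
  imports Defs
begin

text \<open>
  Only the identity element matters. An endomorphism \<open>\<alpha>\<close> fixes \<open>0\<close>, so a right identity \<open>e\<close> of the
  twisted operation satisfies \<open>e = \<alpha>(0) + e = 0\<close>; then \<open>\<alpha>(x) = \<alpha>(x) + 0 = x\<close> for every \<open>x\<close>, which is
  lemma \<open>twisted_right_identity_imp_fixed\<close>. Conversely, the twist by the identity
  is the original operation, at least on the carrier, and being a group depends only on the
  operation there.
\<close>

lemma (in group) twisted_right_identity_imp_fixed: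
  assumes "\<alpha> \<in> hom G G" and "e \<in> carrier G"
    and unit: "\<And>x. x \<in> carrier G \<Longrightarrow> twisted_op G \<alpha> x e = x"
    and "x \<in> carrier G"
  shows "\<alpha> x = x"
proof -
  have "\<alpha> \<one> = \<one>"
    using assms(1) by (rule hom_one) unfold_locales
  then have "e = \<one>"
    using unit[of \<one>] assms(2) by (simp add: twisted_op_def)
  then show ?thesis
    using unit[of x] assms(1,4) by (simp add: twisted_op_def hom_in_carrier)
qed

text \<open>
  An element of \<open>AutoGroup G\<close> is undefined outside the carrier, so the operation twisted by its
  identity agrees with the multiplication of \<open>G\<close> only on the carrier. The two need not be equal as
  functions, so the group axioms have to be transferred.
\<close>

lemma (in group) group_under_cong:
  assumes "\<And>x y. x \<in> carrier G \<Longrightarrow> y \<in> carrier G \<Longrightarrow> f x y = x \<otimes> y"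
  shows "group_under (carrier G) f"
  unfolding group_under_def
proof
  show "group \<lparr>carrier = carrier G, mult = f, one = \<one>\<rparr>"
    by (rule groupI) (auto simp: assms m_assoc intro: l_inv_ex)
qed

theorem proposition7:
  fixes G :: "('a, 'b) monoid_scheme" and \<alpha> :: "'a \<Rightarrow> 'a"
  assumes "comm_group G"
    and "\<alpha> \<in> carrier (AutoGroup G)"
    and "\<alpha> [^]\<^bsub>AutoGroup G\<^esub> (2::nat) = \<one>\<^bsub>AutoGroup G\<^esub>"
  shows "group_under (carrier G) (twisted_op G \<alpha>) \<longleftrightarrow> \<alpha> = \<one>\<^bsub>AutoGroup G\<^esub>"
proof -
  interpret comm_group G by fact
  have hom: "\<alpha> \<in> hom G G" and ext: "\<alpha> \<in> extensional (carrier G)"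
    using assms(2) by (auto simp: AutoGroup_def auto_def Bij_def)
  have one: "\<one>\<^bsub>AutoGroup G\<^esub> = (\<lambda>x \<in> carrier G. x)"
    by (simp add: AutoGroup_def BijGroup_def)
  show ?thesis
  proof
    assume "group_under (carrier G) (twisted_op G \<alpha>)"
    then obtain e where "group \<lparr>carrier = carrier G, mult = twisted_op G \<alpha>, one = e\<rparr>"
      by (auto simp: group_under_def)
    then interpret T: group "\<lparr>carrier = carrier G, mult = twisted_op G \<alpha>, one = e\<rparr>" .
    have "\<alpha> x = x" if "x \<in> carrier G" for x
      using twisted_right_identity_imp_fixed[OF hom _ _ that] T.one_closed T.r_one by simp
    then show "\<alpha> = \<one>\<^bsub>AutoGroup G\<^esub>"
      unfolding one using ext by (auto intro: extensionalityI)
  next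
    assume "\<alpha> = \<one>\<^bsub>AutoGroup G\<^esub>"
    then show "group_under (carrier G) (twisted_op G \<alpha>)"
      by (intro group_under_cong) (simp add: one twisted_op_def)
  qed
qed

end
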